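(* For every integer $\ell \geq 3$ there is a constant $c(\ell)$ depending only on $\ell$ such that for all $n$, \[ \mathrm{ex}^*(n, C_\ell, P_\ell) \leq (2\ell-3)^{\ell-2}\cdot \mathrm{ex}^*(n, P_\ell) \leq c(\ell)\, n. \]
   Context: An edge-coloring is proper if any two edges sharing a vertex receive different colors. An edge-colored subgraph is rainbow if no two of its edges have the same color. $P_\ell$ denotes the path with $\ell$ edges and $C_\ell$ the cycle of length $\ell$. $\mathrm{ex}^*(n,F)$ is the maximum number of edges in an $n$-vertex simple graph with a proper edge-coloring containing no rainbow copy of $F$. $\mathrm{ex}^*(n,H,F)$ is the maximum number of rainbow copies of $H$ (as subgraphs) in an $n$-vertex simple graph with a proper edge-coloring containing no rainbow copy of $F$. *)

theory Defs
  imports Complex_Main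
begin

text \<open>A graph is a pair of a vertex set and a set of two-element vertex sets.\<close>

type_synonym 'a graph = "'a set \<times> 'a set set"

abbreviation verts :: "'a graph \<Rightarrow> 'a set" where "verts \<equiv> fst"
abbreviation edges :: "'a graph \<Rightarrow> 'a set set" where "edges \<equiv> snd"

definition simple_graph :: "'a graph \<Rightarrow> bool" where
  "simple_graph G \<longleftrightarrow> (\<forall>e\<in>edges G. e \<subseteq> verts G \<and> card e = 2)"

definition subgraph :: "'a graph \<Rightarrow> 'a graph \<Rightarrow> bool" where
  "subgraph S G \<longleftrightarrow> simple_graph S \<and> verts S \<subseteq> verts G \<and> edges S \<subseteq> edges G"

definition isomorphic :: "'a graph \<Rightarrow> 'b graph \<Rightarrow> bool" where
  "isomorphic G H \<longleftrightarrow>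
     (\<exists>f. bij_betw f (verts G) (verts H) \<and> edges H = (\<lambda>e. f ` e) ` edges G)"

definition path_graph :: "nat \<Rightarrow> nat graph" where
  "path_graph l = ({0..l}, {{i, i + 1} | i. i < l})"

text \<open>This is a cycle only for \<open>l \<ge> 3\<close>; smaller values are degenerate.\<close>

definition cycle_graph :: "nat \<Rightarrow> nat graph" where
  "cycle_graph l = ({0..<l}, {{i, (i + 1) mod l} | i. i < l})"

definition proper_coloring :: "'a graph \<Rightarrow> ('a set \<Rightarrow> 'c) \<Rightarrow> bool" where
  "proper_coloring G c \<longleftrightarrow>
     (\<forall>e\<in>edges G. \<forall>f\<in>edges G. e \<noteq> f \<and> e \<inter> f \<noteq> {} \<longrightarrow> c e \<noteq> c f)"

definition rainbow :: "('a set \<Rightarrow> 'c) \<Rightarrow> 'a graph \<Rightarrow> bool" where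
  "rainbow c S \<longleftrightarrow> inj_on c (edges S)"

text \<open>Copies are subgraphs, not embeddings, so they are counted without regard to
  automorphisms of \<open>H\<close>.\<close>

definition rainbow_copies :: "'b graph \<Rightarrow> 'a graph \<Rightarrow> ('a set \<Rightarrow> 'c) \<Rightarrow> 'a graph set" where
  "rainbow_copies H G c = {S. subgraph S G \<and> isomorphic H S \<and> rainbow c S}"

text \<open>Finite graphs have finitely many edges, so drawing vertices and colors from the
  natural numbers is no restriction up to renaming.\<close>

definition rainbow_free :: "nat \<Rightarrow> 'b graph \<Rightarrow> nat graph \<Rightarrow> (nat set \<Rightarrow> nat) \<Rightarrow> bool" where
  "rainbow_free n F G c \<longleftrightarrow>
     simple_graph G \<and> finite (verts G) \<and> card (verts G) = n \<and>
     proper_coloring G c \<and> rainbow_copies F G c = {}"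

text \<open>In both definitions the values are bounded in terms of \<open>n\<close>, so the set is finite.
  It is nonempty as soon as \<open>F\<close> has an edge, as witnessed by the edgeless graph.\<close>

definition ex_rainbow :: "nat \<Rightarrow> 'b graph \<Rightarrow> nat" where
  "ex_rainbow n F = Max {card (edges G) | G c. rainbow_free n F G c}"

definition ex_rainbow_gen :: "nat \<Rightarrow> 'a graph \<Rightarrow> 'b graph \<Rightarrow> nat" where
  "ex_rainbow_gen n H F = Max {card (rainbow_copies H G c) | G c. rainbow_free n F G c}"

end

theory Submission
  imports Defs
begin

text \<open>If a vertex \<open>v\<close> of a rainbow \<open>C\<^sub>l\<close> has a neighbor \<open>w\<close> off the cycle, then walking from \<open>w\<close>
  to \<open>v\<close> and on around the cycle gives a \<open>P\<^sub>l\<close>. It is not rainbow, and \<open>vw\<close> differs in color from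
  the next edge, so its color is one of the \<open>l - 2\<close> colors of the remaining edges. Hence vertices
  on rainbow cycles have degree at most \<open>(l - 1) + (l - 2) = 2l - 3\<close>, and at most
  \<open>(2l - 3) ^ (l - 2)\<close> rainbow cycles start with a prescribed oriented edge. Orienting edges upwards
  suffices, since a cycle traversed from its least vertex starts with an increasing step. The number
  of edges is linear because a minimum degree of at least \<open>2l\<close> lets one build a rainbow \<open>P\<^sub>l\<close>
  greedily.\<close>

section \<open>Neighborhoods and parametrized rainbow paths and cycles\<close>

definition neighbors :: "'a graph \<Rightarrow> 'a \<Rightarrow> 'a set" where
  "neighbors G v = {w. {v, w} \<in> edges G}"

text \<open>A parametrization instead of a subgraph: only the values of \<open>f\<close> on
  \<open>{0..k}\<close> matter, so a vertex is appended by a function update and prepended by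
  \<open>case_nat\<close>.\<close>

definition rainbow_path :: "'a graph \<Rightarrow> ('a set \<Rightarrow> 'c) \<Rightarrow> nat \<Rightarrow> (nat \<Rightarrow> 'a) \<Rightarrow> bool" where
  "rainbow_path G c k f \<longleftrightarrow> inj_on f {0..k} \<and> f ` {0..k} \<subseteq> verts G \<and>
     (\<forall>i<k. {f i, f (Suc i)} \<in> edges G) \<and> inj_on (\<lambda>i. c {f i, f (Suc i)}) {..<k}"

definition rainbow_cycle :: "'a graph \<Rightarrow> ('a set \<Rightarrow> 'c) \<Rightarrow> nat \<Rightarrow> (nat \<Rightarrow> 'a) \<Rightarrow> bool" where
  "rainbow_cycle G c l f \<longleftrightarrow> inj_on f {..<l} \<and>
     (\<forall>i<l. {f i, f (Suc i mod l)} \<in> edges G) \<and> inj_on (\<lambda>i. c {f i, f (Suc i mod l)}) {..<l}"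

lemma simple_graph_edgeD:
  assumes "simple_graph G" "{v, w} \<in> edges G"
  shows "v \<in> verts G" "w \<in> verts G" "v \<noteq> w"
  using assms by (force simp: simple_graph_def)+

lemma neighbors_subset_verts: "simple_graph G \<Longrightarrow> neighbors G v \<subseteq> verts G"
  by (auto simp: neighbors_def dest: simple_graph_edgeD)

lemma finite_neighbors: "simple_graph G \<Longrightarrow> finite (verts G) \<Longrightarrow> finite (neighbors G v)"
  by (rule finite_subset[OF neighbors_subset_verts])

lemma finite_edges: "simple_graph G \<Longrightarrow> finite (verts G) \<Longrightarrow> finite (edges G)"
  by (rule finite_subset[of _ "Pow (verts G)"]) (auto simp: simple_graph_def)

text \<open>Edges at \<open>v\<close> meet in \<open>v\<close>, so properness separates their
  colors. This lets colors count neighbors: a set of \<open>m\<close> colors accounts for at most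
  \<open>m\<close> of them.\<close>

lemma inj_on_color_neighbors:
  assumes "proper_coloring G c"
  shows "inj_on (\<lambda>w. c {v, w}) (neighbors G v)"
proof (rule inj_onI)
  fix w w' assume "w \<in> neighbors G v" "w' \<in> neighbors G v" and eq: "c {v, w} = c {v, w'}"
  then have "{v, w} \<in> edges G" "{v, w'} \<in> edges G" "{v, w} \<inter> {v, w'} \<noteq> {}"
    by (auto simp: neighbors_def)
  with eq have "{v, w} = {v, w'}"
    using assms unfolding proper_coloring_def by metis
  then show "w = w'" by (auto simp: doubleton_eq_iff)
qed

section \<open>Greedy rainbow paths and the linear edge bound\<close>

lemma rainbow_path_imp_copy:
  assumes "rainbow_path G c k f"
  shows "rainbow_copies (path_graph k) G c \<noteq> {}"
proof -
  let ?E = "(\<lambda>i. {f i, f (Suc i)}) ` {..<k}"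
  let ?S = "(f ` {0..k}, ?E)"
  have inj: "inj_on f {0..k}" and V: "f ` {0..k} \<subseteq> verts G"
    and E: "\<And>i. i < k \<Longrightarrow> {f i, f (Suc i)} \<in> edges G"
    and c: "inj_on (\<lambda>i. c {f i, f (Suc i)}) {..<k}"
    using assms by (auto simp: rainbow_path_def)
  have "f i \<noteq> f (Suc i)" if "i < k" for i
    using inj_onD[OF inj, of i "Suc i"] that by auto
  then have "subgraph ?S G"
    using V E by (auto simp: subgraph_def simple_graph_def)
  moreover have "isomorphic (path_graph k) ?S"
    unfolding isomorphic_def
  proof (intro exI[of _ f] conjI)
    show "bij_betw f (verts (path_graph k)) (verts ?S)"
      using inj by (simp add: path_graph_def bij_betw_def)
    have "edges (path_graph k) = (\<lambda>i. {i, Suc i}) ` {..<k}"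
      by (auto simp: path_graph_def)
    then show "edges ?S = (`) f ` edges (path_graph k)"
      by (simp add: image_image)
  qed
  moreover have "rainbow c ?S"
    using c by (auto simp: rainbow_def intro!: inj_on_imageI simp: o_def)
  ultimately show ?thesis
    unfolding rainbow_copies_def by blast
qed

text \<open>Greedy extension at the end \<open>f k\<close>: at most \<open>k\<close> neighbors are
  earlier path vertices and at most \<open>k\<close> are reached by a color already used. As
  \<open>k < l\<close> before each step, \<open>2 * l\<close> neighbors leave a free one.\<close>

lemma rainbow_path_exists:
  assumes G: "simple_graph G" "finite (verts G)" "proper_coloring G c" "verts G \<noteq> {}"
    and deg: "\<And>v. v \<in> verts G \<Longrightarrow> 2 * l \<le> card (neighbors G v)"
    and "k \<le> l"
  shows "\<exists>f. rainbow_path G c k f"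
  using \<open>k \<le> l\<close>
proof (induction k)
  case 0
  from G obtain v where "v \<in> verts G" by blast
  then have "rainbow_path G c 0 (\<lambda>_. v)" by (simp add: rainbow_path_def)
  then show ?case by blast
next
  case (Suc k)
  then obtain f where f: "rainbow_path G c k f" by auto
  let ?v = "f k"
  let ?C = "(\<lambda>i. c {f i, f (Suc i)}) ` {..<k}"
  let ?B = "{w \<in> neighbors G ?v. c {?v, w} \<in> ?C}"
  have v: "?v \<in> verts G" using f by (auto simp: rainbow_path_def)
  have fin: "finite (neighbors G ?v)" using G(1,2) by (rule finite_neighbors)
  have "card ?B \<le> card ?C"
    by (rule card_inj_on_le[of "\<lambda>w. c {?v, w}"])
       (auto intro: inj_on_subset[OF inj_on_color_neighbors[OF G(3)]])
  also have "\<dots> \<le> k" using card_image_le[of "{..<k}"] by fastforce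
  finally have B: "card ?B \<le> k" .
  have "card (f ` {..<k} \<union> ?B) \<le> card (f ` {..<k}) + card ?B" by (rule card_Un_le)
  also have "\<dots> \<le> k + k" using B card_image_le[of "{..<k}" f] by simp
  also have "\<dots> < card (neighbors G ?v)" using deg[OF v] Suc.prems by linarith
  finally have "\<not> neighbors G ?v \<subseteq> f ` {..<k} \<union> ?B"
    using card_mono[of "f ` {..<k} \<union> ?B" "neighbors G ?v"] fin by fastforce
  then obtain w where w: "w \<in> neighbors G ?v" "w \<notin> f ` {..<k}" "c {?v, w} \<notin> ?C" by auto
  have vw: "{?v, w} \<in> edges G" using w by (simp add: neighbors_def)
  \<comment> \<open>The excluded set omitted \<open>f k\<close>; \<open>w\<close> differs from it
    because edges are not loops.\<close>
  have new: "w \<notin> f ` {0..k}"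
    using w simple_graph_edgeD(3)[OF G(1) vw] by (auto simp: le_less)
  let ?g = "f(Suc k := w)"
  have "inj_on ?g {0..Suc k}"
    using f new by (auto simp: rainbow_path_def atLeastAtMostSuc_conv inj_on_fun_updI)
  moreover have "?g ` {0..Suc k} \<subseteq> verts G"
    using f simple_graph_edgeD(2)[OF G(1) vw] by (auto simp: rainbow_path_def)
  moreover have "\<forall>i<Suc k. {?g i, ?g (Suc i)} \<in> edges G"
    using f vw by (auto simp: rainbow_path_def less_Suc_eq)
  moreover have "inj_on (\<lambda>i. c {?g i, ?g (Suc i)}) {..<Suc k}"
  proof -
    have "inj_on (\<lambda>i. c {?g i, ?g (Suc i)}) {..<k} = inj_on (\<lambda>i. c {f i, f (Suc i)}) {..<k}"
      by (rule inj_on_cong) auto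
    moreover have "(\<lambda>i. c {?g i, ?g (Suc i)}) ` {..<k} = ?C"
      by (rule image_cong) auto
    ultimately show ?thesis
      using f w(3) by (simp add: rainbow_path_def lessThan_Suc)
  qed
  ultimately show ?case unfolding rainbow_path_def by blast
qed

text \<open>Induction by deleting a vertex: without a rainbow path, the greedy lemma fails, so some
  vertex has degree below \<open>2 * l\<close>. Its removal costs fewer than \<open>2 * l\<close>
  edges and creates no new copies.\<close>

lemma card_edges_le_linear:
  assumes "simple_graph G" "finite (verts G)" "proper_coloring G c"
    "rainbow_copies (path_graph l) G c = {}"
  shows "card (edges G) \<le> 2 * l * card (verts G)"
  using assms
proof (induction "card (verts G)" arbitrary: G)
  case 0
  then have "edges G = {}" by (fastforce simp: simple_graph_def)
  then show ?case by simp
next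
  case (Suc n)
  have "verts G \<noteq> {}" using Suc.hyps by auto
  moreover have "\<nexists>f. rainbow_path G c l f"
    using rainbow_path_imp_copy[of G c l] Suc.prems(4) by auto
  ultimately obtain v where v: "v \<in> verts G" "card (neighbors G v) < 2 * l"
    using rainbow_path_exists[OF Suc.prems(1-3), of l l] by force
  let ?H = "(verts G - {v}, {e \<in> edges G. v \<notin> e})"
  have "rainbow_copies (path_graph l) ?H c \<subseteq> rainbow_copies (path_graph l) G c"
    by (auto simp: rainbow_copies_def subgraph_def)
  moreover have "simple_graph ?H" "proper_coloring ?H c"
    using Suc.prems by (auto simp: simple_graph_def proper_coloring_def)
  ultimately have H: "card (edges ?H) \<le> 2 * l * card (verts ?H)"
    using Suc.prems Suc.hyps(2) v by (intro Suc.hyps(1)) auto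
  let ?D = "{e \<in> edges G. v \<in> e}"
  have "?D \<subseteq> (\<lambda>w. {v, w}) ` neighbors G v"
  proof
    fix e assume e: "e \<in> ?D"
    then have "card e = 2" using Suc.prems(1) by (auto simp: simple_graph_def)
    then obtain x y where "e = {x, y}" by (auto simp: card_2_iff)
    with e show "e \<in> (\<lambda>w. {v, w}) ` neighbors G v"
      by (auto simp: neighbors_def insert_commute)
  qed
  then have "card ?D \<le> card (neighbors G v)"
    by (rule surj_card_le[OF finite_neighbors[OF Suc.prems(1,2)]])
  moreover have "card (edges G) \<le> card (edges ?H) + card ?D"
  proof -
    have "edges G = edges ?H \<union> ?D" by auto
    then show ?thesis using card_Un_le[of "edges ?H" ?D] by simp
  qed
  ultimately have "card (edges G) \<le> 2 * l * card (verts ?H) + 2 * l"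
    using H v(2) by linarith
  also have "\<dots> = 2 * l * card (verts G)"
  proof -
    have "card (verts G) = Suc (card (verts ?H))"
      using card_Suc_Diff1[OF Suc.prems(2) v(1)] by simp
    then show ?thesis by simp
  qed
  finally show ?case .
qed

section \<open>Rotating rainbow cycles and bounding degrees on them\<close>

lemma image_add_mod:
  fixes l j :: nat
  assumes "l > 0"
  shows "(\<lambda>i. (i + j) mod l) ` {..<l} = {..<l}"
proof
  show "(\<lambda>i. (i + j) mod l) ` {..<l} \<subseteq> {..<l}" using assms by auto
  show "{..<l} \<subseteq> (\<lambda>i. (i + j) mod l) ` {..<l}"
  proof
    fix i assume i: "i \<in> {..<l}"
    \<comment> \<open>The preimage is \<open>i - j\<close> modulo \<open>l\<close>; adding
      \<open>l - j mod l\<close> avoids truncated subtraction.\<close>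
    have "((i + (l - j mod l)) mod l + j) mod l = (i + (l - j mod l) + j mod l) mod l"
      by (simp add: mod_simps)
    also have "\<dots> = (i + l) mod l"
      using mod_less_divisor[OF assms, of j] by simp
    also have "\<dots> = i" using i by simp
    finally show "i \<in> (\<lambda>i. (i + j) mod l) ` {..<l}"
      using assms by (intro image_eqI[of _ _ "(i + (l - j mod l)) mod l"]) auto
  qed
qed

text \<open>The shift permutes the indices and commutes with the cyclic successor, so all three
  conditions are merely reindexed. Thus any cycle vertex can be moved to position 0.\<close>

lemma rainbow_cycle_rotate:
  assumes "rainbow_cycle G c l f"
  shows "rainbow_cycle G c l (\<lambda>i. f ((i + j) mod l))"
proof (cases "l = 0")
  case True
  then show ?thesis by (simp add: rainbow_cycle_def)
next
  case False
  let ?r = "\<lambda>i. (i + j) mod l"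
  have r: "?r ` {..<l} \<subseteq> {..<l}" using False by auto
  \<comment> \<open>A surjection of a finite set onto itself is injective.\<close>
  have inj: "inj_on ?r {..<l}"
    using image_add_mod[of l j] False by (intro eq_card_imp_inj_on) auto
  have suc: "?r (Suc i mod l) = Suc (?r i) mod l" for i
    by (simp add: mod_simps)
  have rng: "?r i < l" for i using False by simp
  have "inj_on (f \<circ> ?r) {..<l}"
    using assms r by (intro comp_inj_on inj) (auto simp: rainbow_cycle_def intro: inj_on_subset)
  moreover have "inj_on ((\<lambda>i. c {f i, f (Suc i mod l)}) \<circ> ?r) {..<l}"
    using assms r by (intro comp_inj_on inj) (auto simp: rainbow_cycle_def intro: inj_on_subset)
  ultimately show ?thesis
    using assms rng unfolding rainbow_cycle_def o_def suc by blast
qed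

lemma card_neighbors_cycle_start:
  assumes G: "simple_graph G" "proper_coloring G c" "rainbow_copies (path_graph l) G c = {}"
    and "l \<ge> 3" and f: "rainbow_cycle G c l f"
  shows "card (neighbors G (f 0)) \<le> 2 * l - 3"
proof -
  let ?N = "neighbors G (f 0)"
  let ?I = "f ` {1..<l}"
  let ?col = "\<lambda>i. c {f i, f (Suc i)}"
  \<comment> \<open>The colors of the \<open>l - 2\<close> cycle edges that avoid
    \<open>f 0\<close>.\<close>
  let ?C = "?col ` {1..<l - 1}"
  have inj: "inj_on f {..<l}" and c: "inj_on (\<lambda>i. c {f i, f (Suc i mod l)}) {..<l}"
    and E': "\<And>i. i < l \<Longrightarrow> {f i, f (Suc i mod l)} \<in> edges G"
    using f by (auto simp: rainbow_cycle_def)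
  have E: "{f i, f (Suc i)} \<in> edges G" if "i < l - 1" for i
    using E'[of i] that by simp
  have c': "inj_on ?col {..<l - 1}"
  proof -
    have "inj_on ?col {..<l - 1} = inj_on (\<lambda>i. c {f i, f (Suc i mod l)}) {..<l - 1}"
      by (rule inj_on_cong) auto
    then show ?thesis using inj_on_subset[OF c] by auto
  qed
  have color: "c {f 0, w} \<in> ?C" if w: "w \<in> ?N" "w \<notin> ?I" for w
  proof (rule ccontr)
    assume nC: "c {f 0, w} \<notin> ?C"
    have e: "{f 0, w} \<in> edges G" using w by (simp add: neighbors_def)
    have new: "w \<notin> f ` {..<l}"
    proof
      assume "w \<in> f ` {..<l}"
      then obtain i where "i < l" "w = f i" by auto
      then show False using w(2) simple_graph_edgeD(3)[OF G(1) e] by (cases "i = 0") auto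
    qed
    \<comment> \<open>The first cycle edge also starts at \<open>f 0\<close>, so properness excludes
      its color for the edge to \<open>w\<close>.\<close>
    have "f 1 \<in> ?N" using E[of 0] \<open>l \<ge> 3\<close> by (simp add: neighbors_def)
    moreover have "f 1 \<noteq> w" using new \<open>l \<ge> 3\<close> by auto
    ultimately have "c {f 0, w} \<noteq> ?col 0"
      using inj_on_color_neighbors[OF G(2), of "f 0"] w(1) by (auto dest: inj_onD)
    with nC have nC': "c {f 0, w} \<notin> ?col ` {..<l - 1}"
    proof -
      have "{..<l - 1} = insert 0 {1..<l - 1}" using \<open>l \<ge> 3\<close> by auto
      then show ?thesis using nC \<open>c {f 0, w} \<noteq> ?col 0\<close> by simp
    qed
    \<comment> \<open>The path \<open>w, f 0, ..., f (l - 1)\<close>: the new edge replaces the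
      closing edge of the cycle, so there are again \<open>l\<close> edges.\<close>
    let ?h = "case_nat w f"
    have Suc_l: "{0..l} = insert 0 (Suc ` {..<l})" "{..<l} = insert 0 (Suc ` {..<l - 1})"
      using \<open>l \<ge> 3\<close> unfolding image_Suc_lessThan by auto
    have "inj_on ?h {0..l}"
      using inj new unfolding Suc_l(1) by (auto simp: inj_on_def)
    moreover have "?h ` {0..l} \<subseteq> verts G"
      using simple_graph_edgeD(2)[OF G(1) e] simple_graph_edgeD(1)[OF G(1) E']
      unfolding Suc_l(1) by auto
    moreover have "\<forall>i<l. {?h i, ?h (Suc i)} \<in> edges G"
      using e E by (auto split: nat.split simp: insert_commute)
    moreover have "inj_on (\<lambda>i. c {?h i, ?h (Suc i)}) {..<l}"
      using c' nC' unfolding Suc_l(2)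
      by (auto simp: inj_on_def insert_commute image_iff) (metis lessThan_iff)
    ultimately have "rainbow_path G c l ?h" by (simp add: rainbow_path_def)
    then show False using rainbow_path_imp_copy G(3) by blast
  qed
  have outer: "inj_on (\<lambda>w. c {f 0, w}) (?N - ?I)" "(\<lambda>w. c {f 0, w}) ` (?N - ?I) \<subseteq> ?C"
    using inj_on_subset[OF inj_on_color_neighbors[OF G(2)] Diff_subset] color by blast+
  have "card (?N - ?I) \<le> card ?C"
    by (rule card_inj_on_le[OF outer]) simp
  also have "\<dots> \<le> l - 2" using card_image_le[of "{1..<l - 1}" ?col] by simp
  finally have out: "card (?N - ?I) \<le> l - 2" .
  have "card ?N \<le> card (?I \<union> (?N - ?I))"
  proof (rule card_mono)
    \<comment> \<open>The injection into the finite set \<open>?C\<close> also supplies the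
      finiteness that \<open>card_mono\<close> requires.\<close>
    have "finite (?N - ?I)"
      by (rule inj_on_finite[OF outer]) simp
    then show "finite (?I \<union> (?N - ?I))" by simp
  qed auto
  also have "\<dots> \<le> card ?I + card (?N - ?I)" by (rule card_Un_le)
  also have "\<dots> \<le> (l - 1) + (l - 2)"
    using out card_image_le[of "{1..<l}" f] by simp
  finally show ?thesis using \<open>l \<ge> 3\<close> by simp
qed

lemma card_neighbors_cycle:
  assumes "simple_graph G" "proper_coloring G c" "rainbow_copies (path_graph l) G c = {}"
    and "l \<ge> 3" and "rainbow_cycle G c l f" and "j < l"
  shows "card (neighbors G (f j)) \<le> 2 * l - 3"
  using card_neighbors_cycle_start[OF assms(1-4) rainbow_cycle_rotate[OF assms(5), of j]] \<open>j < l\<close>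
  by simp

section \<open>Counting rainbow cycles by walks\<close>

text \<open>Walks on \<open>k + 2\<close> vertices. The increasing first step gives each edge one
  orientation only, saving a factor 2. The bound \<open>D\<close> is checked wherever a next vertex
  is chosen, so each choice costs a factor of at most \<open>D\<close>.\<close>

primrec bounded_walks :: "'a::linorder graph \<Rightarrow> nat \<Rightarrow> nat \<Rightarrow> 'a list set" where
  "bounded_walks G D 0 = {[x, y] | x y. {x, y} \<in> edges G \<and> x < y}"
| "bounded_walks G D (Suc k) =
     (\<Union>xs \<in> {xs \<in> bounded_walks G D k. card (neighbors G (last xs)) \<le> D}.
        (\<lambda>z. xs @ [z]) ` neighbors G (last xs))"

lemma card_bounded_walks:
  assumes "simple_graph G" "finite (verts G)"
  shows "finite (bounded_walks G D k) \<and> card (bounded_walks G D k) \<le> D ^ k * card (edges G)"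
proof (induction k)
  case 0
  \<comment> \<open>Forgetting the order loses nothing here, since \<open>x < y\<close> recovers
    it.\<close>
  have inj: "inj_on set (bounded_walks G D 0)"
    by (auto simp: inj_on_def doubleton_eq_iff)
  have sub: "set ` bounded_walks G D 0 \<subseteq> edges G" by auto
  show ?case
    using inj_on_finite[OF inj sub] card_inj_on_le[OF inj sub] finite_edges[OF assms] by simp
next
  case (Suc k)
  let ?A = "{xs \<in> bounded_walks G D k. card (neighbors G (last xs)) \<le> D}"
  have fin: "finite ?A" using Suc by simp
  have "card (bounded_walks G D (Suc k))
      \<le> (\<Sum>xs\<in>?A. card ((\<lambda>z. xs @ [z]) ` neighbors G (last xs)))"
    unfolding bounded_walks.simps by (rule card_UN_le[OF fin])
  also have "\<dots> \<le> (\<Sum>xs\<in>?A. D)"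
    by (intro sum_mono) (auto intro!: order_trans[OF card_image_le] finite_neighbors assms)
  also have "\<dots> = D * card ?A" by simp
  also have "\<dots> \<le> D * card (bounded_walks G D k)"
    using Suc by (intro mult_left_mono card_mono) auto
  also have "\<dots> \<le> D ^ Suc k * card (edges G)" using Suc by (simp add: mult.assoc)
  finally show ?case using fin finite_neighbors[OF assms] by simp
qed

lemma map_in_bounded_walks:
  assumes "f 0 < f (Suc 0)"
    and "\<And>i. i \<le> k \<Longrightarrow> {f i, f (Suc i)} \<in> edges G"
    and "\<And>i. i \<le> k \<Longrightarrow> card (neighbors G (f i)) \<le> D"
  shows "map f [0..<k + 2] \<in> bounded_walks G D k"
  using assms
proof (induction k)
  case 0
  then show ?case by auto
next
  case (Suc k)
  then have "map f [0..<k + 2] \<in> bounded_walks G D k" by simp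
  moreover have "last (map f [0..<k + 2]) = f (Suc k)" by simp
  moreover have "f (k + 2) \<in> neighbors G (f (Suc k))"
    using Suc.prems(2)[of "Suc k"] by (simp add: neighbors_def)
  moreover have "map f [0..<Suc k + 2] = map f [0..<k + 2] @ [f (k + 2)]" by simp
  ultimately show ?case
    using Suc.prems(3)[of "Suc k"] unfolding bounded_walks.simps by force
qed

text \<open>The isomorphism itself is the parametrization. The work lies in passing from colors
  injective on edges to colors injective on indices.\<close>

lemma cycle_copy_imp_rainbow_cycle:
  assumes S: "S \<in> rainbow_copies (cycle_graph l) G c" and "l \<ge> 3"
  obtains f where "rainbow_cycle G c l f" "S = (f ` {..<l}, (\<lambda>i. {f i, f (Suc i mod l)}) ` {..<l})"
proof -
  obtain f where bij: "bij_betw f (verts (cycle_graph l)) (verts S)"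
    and ES: "edges S = (`) f ` edges (cycle_graph l)"
    using S by (auto simp: rainbow_copies_def isomorphic_def)
  have inj: "inj_on f {..<l}" and V: "verts S = f ` {..<l}"
    using bij by (auto simp: cycle_graph_def bij_betw_def atLeast0LessThan)
  have cyc: "edges (cycle_graph l) = (\<lambda>i. {i, Suc i mod l}) ` {..<l}"
    by (auto simp: cycle_graph_def)
  have E: "edges S = (\<lambda>i. {f i, f (Suc i mod l)}) ` {..<l}"
    unfolding ES cyc by (simp add: image_image)
  have "inj_on (\<lambda>i. {f i, f (Suc i mod l)}) {..<l}"
  proof (rule inj_onI)
    fix i j assume ij: "i \<in> {..<l}" "j \<in> {..<l}"
      and "{f i, f (Suc i mod l)} = {f j, f (Suc j mod l)}"
    then consider "f i = f j" | "f i = f (Suc j mod l)" "f (Suc i mod l) = f j"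
      by (auto simp: doubleton_eq_iff)
    then show "i = j"
    proof cases
      case 1
      then show ?thesis using inj ij by (auto dest: inj_onD)
    next
      case 2
      \<comment> \<open>Here \<open>i\<close> and \<open>j\<close> would be cyclic successors of
        each other, so \<open>l\<close> would divide 2; this is excluded by
        \<open>l \<ge> 3\<close>.\<close>
      then have "i = Suc j mod l" "Suc i mod l = j"
        by (intro inj_onD[OF inj]; use ij \<open>l \<ge> 3\<close> in simp)+
      then show ?thesis using ij \<open>l \<ge> 3\<close> by (auto simp: mod_Suc split: if_splits)
    qed
  qed
  moreover have "inj_on c (edges S)" using S by (simp add: rainbow_copies_def rainbow_def)
  ultimately have "inj_on (\<lambda>i. c {f i, f (Suc i mod l)}) {..<l}"
    unfolding E using comp_inj_on[of "\<lambda>i. {f i, f (Suc i mod l)}" "{..<l}" c] by (simp add: o_def)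
  moreover have "edges S \<subseteq> edges G" using S by (simp add: rainbow_copies_def subgraph_def)
  ultimately have "rainbow_cycle G c l f"
    using inj E by (auto simp: rainbow_cycle_def)
  moreover have "S = (f ` {..<l}, (\<lambda>i. {f i, f (Suc i mod l)}) ` {..<l})"
    using V E by (simp add: prod_eq_iff)
  ultimately show ?thesis using that by blast
qed

text \<open>Closing up walks on \<open>l\<close> vertices covers all rainbow cycles. Walks in
  \<open>?W\<close> that do not close to a cycle do no harm to an upper bound.\<close>

lemma card_rainbow_cycles_le:
  fixes G :: "'a::linorder graph"
  assumes G: "simple_graph G" "finite (verts G)" "proper_coloring G c"
    "rainbow_copies (path_graph l) G c = {}" and "l \<ge> 3"
  shows "card (rainbow_copies (cycle_graph l) G c) \<le> (2 * l - 3) ^ (l - 2) * card (edges G)"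
proof -
  let ?W = "bounded_walks G (2 * l - 3) (l - 2)"
  let ?g = "\<lambda>xs. (set xs, (\<lambda>i. {xs ! i, xs ! (Suc i mod l)}) ` {..<l})"
  have "rainbow_copies (cycle_graph l) G c \<subseteq> ?g ` ?W"
  proof
    fix S assume "S \<in> rainbow_copies (cycle_graph l) G c"
    then obtain f where f: "rainbow_cycle G c l f"
      and S: "S = (f ` {..<l}, (\<lambda>i. {f i, f (Suc i mod l)}) ` {..<l})"
      using cycle_copy_imp_rainbow_cycle \<open>l \<ge> 3\<close> by blast
    \<comment> \<open>Starting the traversal at the least vertex makes its first step increasing,
      strictly so because edges are not loops.\<close>
    have "Min (f ` {..<l}) \<in> f ` {..<l}" using \<open>l \<ge> 3\<close> by (intro Min_in) (auto simp: lessThan_empty_iff)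
    then obtain j where j: "j < l" "f j = Min (f ` {..<l})" by auto
    define h where "h = (\<lambda>i. f ((i + j) mod l))"
    have h: "rainbow_cycle G c l h" unfolding h_def by (rule rainbow_cycle_rotate[OF f])
    have "h 0 \<le> h 1" using j \<open>l \<ge> 3\<close> by (simp add: h_def)
    moreover have hE: "{h i, h (Suc i)} \<in> edges G" if "i < l - 1" for i
    proof -
      have "{h i, h (Suc i mod l)} \<in> edges G" using h that by (auto simp only: rainbow_cycle_def)
      then show ?thesis using that by simp
    qed
    moreover have "h 0 \<noteq> h 1" using simple_graph_edgeD(3)[OF G(1) hE[of 0]] \<open>l \<ge> 3\<close> by simp
    ultimately have "map h [0..<l - 2 + 2] \<in> ?W"
      using card_neighbors_cycle[OF G(1,3,4) \<open>l \<ge> 3\<close> h] \<open>l \<ge> 3\<close>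
      by (intro map_in_bounded_walks) auto
    moreover have "l - 2 + 2 = l" using \<open>l \<ge> 3\<close> by simp
    ultimately have W: "map h [0..<l] \<in> ?W" by (simp only:)
    have rot: "(\<lambda>i. (i + j) mod l) ` {..<l} = {..<l}"
      using image_add_mod \<open>l \<ge> 3\<close> by simp
    \<comment> \<open>Rotation permutes the indices, so the vertex set and the edge set stay the
      same.\<close>
    have "?g (map h [0..<l]) = S"
    proof -
      have "set (map h [0..<l]) = f ` (\<lambda>i. (i + j) mod l) ` {..<l}"
        by (simp add: h_def image_image atLeast0LessThan)
      moreover have "(\<lambda>i. {map h [0..<l] ! i, map h [0..<l] ! (Suc i mod l)}) ` {..<l}
          = (\<lambda>i. {f i, f (Suc i mod l)}) ` (\<lambda>i. (i + j) mod l) ` {..<l}"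
        unfolding image_image using \<open>l \<ge> 3\<close> by (intro image_cong) (auto simp: h_def mod_simps)
      ultimately show ?thesis unfolding rot S by simp
    qed
    then show "S \<in> ?g ` ?W" using W by blast
  qed
  then have "card (rainbow_copies (cycle_graph l) G c) \<le> card ?W"
    using card_bounded_walks[OF G(1,2)] by (intro surj_card_le) auto
  then show ?thesis
    using card_bounded_walks[OF G(1,2), of "2 * l - 3" "l - 2"] by linarith
qed

section \<open>Passing to the extremal numbers\<close>

text \<open>A path with an edge has no copy in an edgeless graph. This witness makes the sets under
  \<open>Max\<close> nonempty.\<close>

lemma rainbow_free_edgeless:
  assumes "l \<ge> 1"
  shows "rainbow_free n (path_graph l) ({0..<n}, {}) c"
proof -
  have "edges (path_graph l) \<noteq> {}" using assms by (auto simp: path_graph_def intro: exI[of _ 0])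
  then show ?thesis
    by (auto simp: rainbow_free_def simple_graph_def proper_coloring_def rainbow_copies_def
        subgraph_def isomorphic_def)
qed

lemma ex_rainbow_path:
  assumes "l \<ge> 1"
  shows "rainbow_free n (path_graph l) G c \<Longrightarrow> card (edges G) \<le> ex_rainbow n (path_graph l)"
    and "ex_rainbow n (path_graph l) \<le> 2 * l * n"
proof -
  let ?X = "{card (edges G) | G c. rainbow_free n (path_graph l) G c}"
  have bound: "x \<le> 2 * l * n" if "x \<in> ?X" for x
    using that card_edges_le_linear by (auto simp: rainbow_free_def)
  \<comment> \<open>\<open>Max\<close> is meaningful only on finite sets; the linear bound provides
    this.\<close>
  then have fin: "finite ?X" by (meson finite_nat_set_iff_bounded_le)
  show "card (edges G) \<le> ex_rainbow n (path_graph l)" if "rainbow_free n (path_graph l) G c"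
    unfolding ex_rainbow_def using that by (intro Max_ge fin) blast
  have "?X \<noteq> {}" using rainbow_free_edgeless[OF assms] by blast
  then show "ex_rainbow n (path_graph l) \<le> 2 * l * n"
    unfolding ex_rainbow_def using bound Max_in[OF fin] by blast
qed

theorem theorem7:
  fixes l :: nat
  assumes "l \<ge> 3"
  shows "\<exists>C::real. \<forall>n::nat.
    ex_rainbow_gen n (cycle_graph l) (path_graph l)
      \<le> (2 * l - 3) ^ (l - 2) * ex_rainbow n (path_graph l) \<and>
    real ((2 * l - 3) ^ (l - 2) * ex_rainbow n (path_graph l)) \<le> C * real n"
proof (intro exI allI conjI)
  fix n :: nat
  let ?K = "(2 * l - 3) ^ (l - 2)"
  let ?X = "{card (rainbow_copies (cycle_graph l) G c) | G c. rainbow_free n (path_graph l) G c}"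
  have l: "l \<ge> 1" using assms by simp
  have bound: "x \<le> ?K * ex_rainbow n (path_graph l)" if x: "x \<in> ?X" for x
  proof -
    obtain G c where x: "x = card (rainbow_copies (cycle_graph l) G c)"
      and G: "rainbow_free n (path_graph l) G c" using x by blast
    have "x \<le> ?K * card (edges G)"
      unfolding x using G assms by (intro card_rainbow_cycles_le) (auto simp: rainbow_free_def)
    also have "\<dots> \<le> ?K * ex_rainbow n (path_graph l)"
      using ex_rainbow_path(1)[OF l G] by (rule mult_left_mono) simp
    finally show ?thesis .
  qed
  then have "finite ?X" by (meson finite_nat_set_iff_bounded_le)
  moreover have "?X \<noteq> {}" using rainbow_free_edgeless[OF l] by blast
  ultimately show "ex_rainbow_gen n (cycle_graph l) (path_graph l)
      \<le> ?K * ex_rainbow n (path_graph l)"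
    unfolding ex_rainbow_gen_def using bound Max_in by blast
  have "?K * ex_rainbow n (path_graph l) \<le> ?K * (2 * l * n)"
    using ex_rainbow_path(2)[OF l] by (rule mult_left_mono) simp
  then have "real (?K * ex_rainbow n (path_graph l)) \<le> real (?K * (2 * l * n))"
    by (simp only: of_nat_le_iff)
  \<comment> \<open>This instantiates the constant as \<open>2 * l * (2 * l - 3) ^ (l - 2)\<close>,
    which is independent of \<open>n\<close>.\<close>
  then show "real (?K * ex_rainbow n (path_graph l)) \<le> real (?K * (2 * l)) * real n"
    by (simp add: mult.assoc)
qed

end
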